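(* For a word $w$ over a finite alphabet, the execution of the algorithm $\mathrm{GetAnAttractor}(\mathcal{S}(w))$ on the suffix automaton (DAWG) $\mathcal{S}(w)$ of $w$ that produces a word attractor $P$ runs in time $O(|w|\cdot|P|)$.
   Context: Let $w=w_1w_2\cdots w_n$ be a finite word over a finite alphabet, $n\ge 0$, $|w|=n$. Positions on $w$ are the elements of $\{1,\dots,n\}$. A factor of $w$ is a word $w_{[i,j]}=w_i\cdots w_j$ (the empty word if $j<i$). An occurrence of a non-empty factor $u$ in $w$ is a pair $(i,j)$, $1\le i\le j\le n$, with $u=w_{[i,j]}$; $j$ is its ending position. A set $P\subseteq\{1,\dots,n\}$ is a word attractor of $w$ if every non-empty factor $u$ of $w$ has an occurrence $(i,j)$ in $w$ with $i\le t\le j$ for some $t\in P$. Suffix automaton (DAWG): the states of $\mathcal{S}(w)$ are the equivalence classes of the factors of $w$ (including the empty word), where two factors are equivalent iff they have the same set of ending positions in $w$ (the empty word having ending positions $0,1,\dots,n$). $|\mathcal{S}(w)|$ is the number of states. The initial state $I$ is the class of the empty word. For a factor $u$, $\delta(I,u)$ is the class of $u$. For a state $q$, $\ell[q]$ is the minimum length of the factors in $q$ and $\mathrm{POS}[q]$ is the smallest ending position of any factor in $q$ (so $\mathrm{POS}[I]=0$). Suffix links: for a state $q\neq I$ and any factor $x\in q$, $F[q]$ is the class of the longest suffix of $x$ that does not belong to $q$ (independent of the choice of $x$). The table of prefix states is $T[j]=\delta(I,w_{[1,j]})$ for $1\le j\le n$. The input $\mathcal{S}(w)$ is given with its tables $F$,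 $\ell$, $T$, $\mathrm{POS}$ already computed. Time is counted in the usual unit-cost RAM model (assignments, comparisons, integer arithmetic, table accesses, inserting a state into $\mathit{checked}$, maintaining its cardinality, and inserting a position into $P$ each cost $O(1)$). Algorithm $\mathrm{GetAnAttractor}(\mathcal{S}(w))$: Initialization: for all states $q$ set $d[q]\leftarrow+\infty$; set $P\leftarrow\emptyset$, $\mathit{checked}\leftarrow\{I\}$, $j\leftarrow|w|$. While $j>0$ do: (a) [stacking] set $i\leftarrow j$, $k\leftarrow 1$; while $k\le i$ do: set $q\leftarrow T[i]$; while $\mathrm{POS}[q]=i$ do { if $d[q]\ge\ell[q]$ then set $k\leftarrow\max\{k,\,i-\ell[q]+1\}$; set $q\leftarrow F[q]$ }; set $i\leftarrow i-1$. (b) [adding] set $P\leftarrow P\cup\{k\}$. (c) [updating] for $i=k,k+1,\dots,j$ in this order do: set $e\leftarrow i-k$, $q\leftarrow T[i]$; while $q\neq I$ and $e<d[q]$ do { set $d[q]\leftarrow e$; if $d[q]<\ell[q]$ then { set $\mathit{checked}\leftarrow\mathit{checked}\cup\{q\}$; if $|\mathit{checked}|=|\mathcal{S}(w)|$ then return $P$ and stop }; set $q\leftarrow F[q]$ }. (d) set $j\leftarrow k-1$. *)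

theory Defs
  imports Main "HOL-Library.Sublist" "HOL-Library.Extended_Nat"
begin

section \<open>Words, occurrences, attractors\<close>

text \<open>Positions are numbered from 1; the result is the empty word if \<open>j < i\<close>.\<close>

definition subword :: "'a list \<Rightarrow> nat \<Rightarrow> nat \<Rightarrow> 'a list" where
  "subword w i j = take (j + 1 - i) (drop (i - 1) w)"

definition occurrence :: "'a list \<Rightarrow> 'a list \<Rightarrow> nat \<Rightarrow> nat \<Rightarrow> bool" where
  "occurrence w u i j \<longleftrightarrow> 1 \<le> i \<and> i \<le> j \<and> j \<le> length w \<and> u = subword w i j"

text \<open>The factors of \<open>w\<close> are the words \<open>u\<close> with \<^term>\<open>sublist u w\<close>
  (contiguous sublists, including the empty word).\<close>

definition word_attractor :: "'a list \<Rightarrow> nat set \<Rightarrow> bool" where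
  "word_attractor w P \<longleftrightarrow> P \<subseteq> {1..length w} \<and>
     (\<forall>u. sublist u w \<and> u \<noteq> [] \<longrightarrow> (\<exists>i j. occurrence w u i j \<and> (\<exists>t\<in>P. i \<le> t \<and> t \<le> j)))"


section \<open>The suffix automaton and its tables\<close>

definition end_positions :: "'a list \<Rightarrow> 'a list \<Rightarrow> nat set" where
  "end_positions w u =
     (if u = [] then {0..length w} else {j. \<exists>i. occurrence w u i j})"

definition end_equiv :: "'a list \<Rightarrow> ('a list \<times> 'a list) set" where
  "end_equiv w = {(u, v). sublist u w \<and> sublist v w \<and> end_positions w u = end_positions w v}"

text \<open>The state reached from the initial state by reading the factor \<open>u\<close>,
  that is \<open>\<delta>(I, u)\<close>.\<close>

definition state_of :: "'a list \<Rightarrow> 'a list \<Rightarrow> 'a list set" where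
  "state_of w u = end_equiv w `` {u}"

text \<open>What the algorithm can access: the states, the initial state, the word length, and
  the tables \<open>F\<close>, \<open>\<ell>\<close>, \<open>T\<close>, \<open>POS\<close>.\<close>

record 'q suffix_automaton =
  states :: "'q set"
  init_state :: 'q
  word_length :: nat
  suffix_link :: "'q \<Rightarrow> 'q"
  min_length :: "'q \<Rightarrow> nat"
  prefix_state :: "nat \<Rightarrow> 'q"
  first_pos :: "'q \<Rightarrow> nat"

text \<open>The suffix link of the initial state is meaningless and never read by the algorithm.
  For the other states it does not depend on the chosen member \<open>x\<close>.\<close>

definition link_of :: "'a list \<Rightarrow> 'a list set \<Rightarrow> 'a list set" where
  "link_of w q =
     (let x = (SOME x. x \<in> q) in state_of w (ARG_MAX length s. suffix s x \<and> s \<notin> q))"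

definition dawg :: "'a list \<Rightarrow> 'a list set suffix_automaton" where
  "dawg w = \<lparr>
     states = {u. sublist u w} // end_equiv w,
     init_state = state_of w [],
     word_length = length w,
     suffix_link = link_of w,
     min_length = (\<lambda>q. Min (length ` q)),
     prefix_state = (\<lambda>j. state_of w (subword w 1 j)),
     first_pos = (\<lambda>q. Min (\<Union>u\<in>q. end_positions w u)) \<rparr>"


section \<open>Programs with unit-cost time\<close>

text \<open>Every basic instruction and every evaluation of a test takes one time unit, so
  instructions and tests must be operations that a unit-cost RAM performs in constant time.
  \<open>Return\<close> stops the whole program.\<close>

datatype 's com =
    Basic "'s \<Rightarrow> 's"
  | Return
  | Seq "'s com" "'s com"  (infixr ";;" 60)
  | When "'s \<Rightarrow> bool" "'s com"
  | While "'s \<Rightarrow> bool" "'s com"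

datatype outcome = Finished | Returned

text \<open>\<open>exec c s t r s'\<close>: started in \<open>s\<close>, the program \<open>c\<close> halts after \<open>t\<close> time units
  in \<open>s'\<close>, either by reaching its end or by executing \<open>Return\<close>.\<close>

inductive exec :: "'s com \<Rightarrow> 's \<Rightarrow> nat \<Rightarrow> outcome \<Rightarrow> 's \<Rightarrow> bool" where
  exec_Basic: "exec (Basic f) s 1 Finished (f s)"
| exec_Return: "exec Return s 1 Returned s"
| exec_Seq: "exec c1 s t1 Finished s' \<Longrightarrow> exec c2 s' t2 r s'' \<Longrightarrow> exec (c1 ;; c2) s (t1 + t2) r s''"
| exec_Seq_Returned: "exec c1 s t Returned s' \<Longrightarrow> exec (c1 ;; c2) s t Returned s'"
| exec_When_True: "b s \<Longrightarrow> exec c s t r s' \<Longrightarrow> exec (When b c) s (1 + t) r s'"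
| exec_When_False: "\<not> b s \<Longrightarrow> exec (When b c) s 1 Finished s"
| exec_While_False: "\<not> b s \<Longrightarrow> exec (While b c) s 1 Finished s"
| exec_While_True: "b s \<Longrightarrow> exec c s t1 Finished s' \<Longrightarrow> exec (While b c) s' t2 r s'' \<Longrightarrow>
    exec (While b c) s (1 + t1 + t2) r s''"
| exec_While_Returned: "b s \<Longrightarrow> exec c s t Returned s' \<Longrightarrow>
    exec (While b c) s (1 + t) Returned s'"


section \<open>The algorithm\<close>

text \<open>One component per program variable. The component \<open>todo\<close> only serves to iterate over
  all states during initialization.\<close>

record 'q store =
  dist :: "'q \<Rightarrow> enat"
  attr :: "nat set"
  checked :: "'q set"
  todo :: "'q set"
  jv :: nat
  iv :: nat
  kv :: nat
  ev :: nat
  qv :: 'q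

definition initialization :: "'q suffix_automaton \<Rightarrow> 'q store com" where
  "initialization S =
     Basic (\<lambda>s. s\<lparr>todo := states S\<rparr>) ;;
     While (\<lambda>s. todo s \<noteq> {}) (
       Basic (\<lambda>s. s\<lparr>qv := (SOME q. q \<in> todo s)\<rparr>) ;;
       Basic (\<lambda>s. s\<lparr>todo := todo s - {qv s}\<rparr>) ;;
       Basic (\<lambda>s. s\<lparr>dist := (dist s)(qv s := \<infinity>)\<rparr>)) ;;
     Basic (\<lambda>s. s\<lparr>attr := {}\<rparr>) ;;
     Basic (\<lambda>s. s\<lparr>checked := {init_state S}\<rparr>) ;;
     Basic (\<lambda>s. s\<lparr>jv := word_length S\<rparr>)"

text \<open>Natural number subtraction below never truncates: \<open>\<ell>[q] \<le> POS[q] = i\<close> in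
  \<open>stacking\<close>, \<open>k \<le> i\<close> in \<open>updating\<close>, and \<open>1 \<le> k\<close> throughout.\<close>

definition stacking :: "'q suffix_automaton \<Rightarrow> 'q store com" where
  "stacking S =
     Basic (\<lambda>s. s\<lparr>iv := jv s\<rparr>) ;;
     Basic (\<lambda>s. s\<lparr>kv := 1\<rparr>) ;;
     While (\<lambda>s. kv s \<le> iv s) (
       Basic (\<lambda>s. s\<lparr>qv := prefix_state S (iv s)\<rparr>) ;;
       While (\<lambda>s. first_pos S (qv s) = iv s) (
         When (\<lambda>s. dist s (qv s) \<ge> enat (min_length S (qv s)))
           (Basic (\<lambda>s. s\<lparr>kv := max (kv s) (iv s - min_length S (qv s) + 1)\<rparr>)) ;;
         Basic (\<lambda>s. s\<lparr>qv := suffix_link S (qv s)\<rparr>)) ;;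
       Basic (\<lambda>s. s\<lparr>iv := iv s - 1\<rparr>))"

definition adding :: "'q store com" where
  "adding = Basic (\<lambda>s. s\<lparr>attr := attr s \<union> {kv s}\<rparr>)"

definition updating :: "'q suffix_automaton \<Rightarrow> 'q store com" where
  "updating S =
     Basic (\<lambda>s. s\<lparr>iv := kv s\<rparr>) ;;
     While (\<lambda>s. iv s \<le> jv s) (
       Basic (\<lambda>s. s\<lparr>ev := iv s - kv s\<rparr>) ;;
       Basic (\<lambda>s. s\<lparr>qv := prefix_state S (iv s)\<rparr>) ;;
       While (\<lambda>s. qv s \<noteq> init_state S \<and> enat (ev s) < dist s (qv s)) (
         Basic (\<lambda>s. s\<lparr>dist := (dist s)(qv s := enat (ev s))\<rparr>) ;;
         When (\<lambda>s. dist s (qv s) < enat (min_length S (qv s))) (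
           Basic (\<lambda>s. s\<lparr>checked := checked s \<union> {qv s}\<rparr>) ;;
           When (\<lambda>s. card (checked s) = card (states S)) Return) ;;
         Basic (\<lambda>s. s\<lparr>qv := suffix_link S (qv s)\<rparr>)) ;;
       Basic (\<lambda>s. s\<lparr>iv := iv s + 1\<rparr>))"

definition get_an_attractor :: "'q suffix_automaton \<Rightarrow> 'q store com" where
  "get_an_attractor S =
     initialization S ;;
     While (\<lambda>s. jv s > 0) (
       stacking S ;;
       adding ;;
       updating S ;;
       Basic (\<lambda>s. s\<lparr>jv := kv s - 1\<rparr>))"

text \<open>\<open>runs_from S s P t\<close>: the algorithm on input \<open>S\<close>, started with arbitrary memory
  contents \<open>s\<close>, halts after \<open>t\<close> time units and outputs \<open>P\<close>. On the empty word the main loop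
  is not entered and \<open>Return\<close> is never executed; the output is then the initial value of \<open>P\<close>,
  so the value of \<open>P\<close> at the end is the output in either case.\<close>

definition runs_from :: "'q suffix_automaton \<Rightarrow> 'q store \<Rightarrow> nat set \<Rightarrow> nat \<Rightarrow> bool" where
  "runs_from S s P t \<longleftrightarrow> (\<exists>r s'. exec (get_an_attractor S) s t r s' \<and> P = attr s')"

end

theory Submission
  imports Defs
begin

text \<open>
  The end position sets of the states form a laminar family on \<open>{0..|w|}\<close>, so there are \<open>O(|w|)\<close>
  states. One iteration of the main loop costs \<open>O(|w|)\<close>: stacking visits a state \<open>q\<close> only
  when \<open>i = POS[q]\<close>, and updating assigns increasing values \<open>e\<close>, hence lowers each \<open>d[q]\<close> at most
  once. As \<open>k\<close> decreases strictly from one iteration to the next, there are exactly \<open>|P|\<close> iterations.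

  Correctness: a finite \<open>d[q] = e\<close> is witnessed by an end position \<open>k + e\<close> of \<open>q\<close> with \<open>k \<in> P\<close>, so
  \<open>d[q] < \<ell>[q]\<close> means that all factors in \<open>q\<close> are covered. At the head of the main loop this
  holds for all \<open>q\<close> with \<open>POS[q] > j\<close>: stacking chooses \<open>k\<close> no smaller than \<open>POS[q] - \<ell>[q] + 1\<close>
  for every other uncovered \<open>q\<close>, so those with \<open>POS[q] \<ge> k\<close> become covered by adding \<open>k\<close>.
\<close>

section \<open>Timed executions\<close>

text \<open>Makes the single execution constructed later speak for all executions.
  \<open>SOME\<close> in the initialization is a fixed choice, not a nondeterministic one.\<close>

lemma exec_deterministic:
  "exec c s t r s' \<Longrightarrow> exec c s t2 r2 s2 \<Longrightarrow> t2 = t \<and> r2 = r \<and> s2 = s'"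
proof (induction arbitrary: t2 r2 s2 rule: exec.induct)
  case exec_Basic
  from exec_Basic.prems show ?case by cases auto
next
  case exec_Return
  from exec_Return.prems show ?case by cases auto
next
  case exec_Seq
  from exec_Seq.prems show ?case by cases (use exec_Seq.IH in blast)+
next
  case exec_Seq_Returned
  from exec_Seq_Returned.prems show ?case by cases (use exec_Seq_Returned.IH in blast)+
next
  case exec_When_True
  from exec_When_True.prems show ?case by cases (use exec_When_True.IH exec_When_True.hyps in blast)+
next
  case exec_When_False
  from exec_When_False.prems show ?case by cases (use exec_When_False.hyps in blast)+
next
  case exec_While_False
  from exec_While_False.prems show ?case by cases (use exec_While_False.hyps in blast)+
next
  case exec_While_True
  from exec_While_True.prems show ?case
    by cases (use exec_While_True.IH exec_While_True.hyps in blast)+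
next
  case exec_While_Returned
  from exec_While_Returned.prems show ?case
    by cases (use exec_While_Returned.IH exec_While_Returned.hyps in blast)+
qed

text \<open>A weakest precondition whose postcondition also sees the elapsed time. It asks for a
  halting execution, so termination is included.\<close>

definition runs :: "'s com \<Rightarrow> 's \<Rightarrow> (outcome \<Rightarrow> 's \<Rightarrow> nat \<Rightarrow> bool) \<Rightarrow> bool" where
  "runs c s Q \<longleftrightarrow> (\<exists>t r s'. exec c s t r s' \<and> Q r s' t)"

lemma runs_mono:
  "runs c s Q \<Longrightarrow> (\<And>r s' t. Q r s' t \<Longrightarrow> Q' r s' t) \<Longrightarrow> runs c s Q'"
  unfolding runs_def by blast

inductive_cases exec_BasicE: "exec (Basic f) s t r s'"
inductive_cases exec_ReturnE: "exec Return s t r s'"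
inductive_cases exec_SeqE: "exec (c1 ;; c2) s t r s'"
inductive_cases exec_WhenE: "exec (When b c) s t r s'"

lemma runs_Basic [simp]: "runs (Basic f) s Q \<longleftrightarrow> Q Finished (f s) 1"
  unfolding runs_def by (metis exec_Basic exec_BasicE)

lemma runs_Return [simp]: "runs Return s Q \<longleftrightarrow> Q Returned s 1"
  unfolding runs_def by (metis exec_Return exec_ReturnE)

lemma runs_Seq [simp]:
  "runs (c1 ;; c2) s Q \<longleftrightarrow>
     runs c1 s (\<lambda>r s' t. if r = Finished then runs c2 s' (\<lambda>r' s'' t'. Q r' s'' (t + t'))
                      else Q Returned s' t)" (is "_ \<longleftrightarrow> ?rhs")
proof
  assume "runs (c1 ;; c2) s Q"
  then obtain t r s' where 1: "exec (c1 ;; c2) s t r s'" and Q: "Q r s' t"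
    unfolding runs_def by blast
  from 1 show ?rhs
    using Q unfolding runs_def
    by (elim exec_SeqE) (metis outcome.distinct(1))+
next
  assume ?rhs
  then obtain t r s' where 1: "exec c1 s t r s'"
    and 2: "if r = Finished then runs c2 s' (\<lambda>r' s'' t'. Q r' s'' (t + t')) else Q Returned s' t"
    unfolding runs_def by blast
  then show "runs (c1 ;; c2) s Q" unfolding runs_def
    by (cases r) (auto intro: exec_Seq exec_Seq_Returned)
qed

lemma runs_When [simp]:
  "runs (When b c) s Q \<longleftrightarrow>
     (if b s then runs c s (\<lambda>r s' t. Q r s' (1 + t)) else Q Finished s 1)"
proof (cases "b s")
  case True
  have "exec (When b c) s t r s' \<longleftrightarrow> (\<exists>t'. exec c s t' r s' \<and> t = 1 + t')" for t r s'
    using True exec_When_True[of b s c _ r s'] by (intro iffI; elim exec_WhenE exE conjE) auto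
  then show ?thesis using True unfolding runs_def by auto
next
  case False
  then have "exec (When b c) s t r s' \<longleftrightarrow> t = 1 \<and> r = Finished \<and> s' = s" for t r s'
    using exec_When_False[of b s c] by (intro iffI; elim exec_WhenE exE conjE) auto
  then show ?thesis using False unfolding runs_def by auto
qed

text \<open>The invariant speaks about the time already spent; as every iteration costs time, a bound on
  that time yields termination.\<close>

lemma runs_While:
  assumes inv: "Inv s 0"
    and bounded: "\<And>s t. Inv s t \<Longrightarrow> t \<le> B"
    and step: "\<And>s t. Inv s t \<Longrightarrow> b s \<Longrightarrow>
      runs c s (\<lambda>r s' t'. if r = Finished then Inv s' (t + 1 + t') else Q Returned s' (t + 1 + t'))"
    and exit: "\<And>s t. Inv s t \<Longrightarrow> \<not> b s \<Longrightarrow> Q Finished s (t + 1)"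
  shows "runs (While b c) s Q"
proof -
  have "runs (While b c) s (\<lambda>r s' t'. Q r s' (t + t'))" if "Inv s t" for s t
    using that
  proof (induction "B - t" arbitrary: s t rule: less_induct)
    case less
    show ?case
    proof (cases "b s")
      case True
      obtain t1 r1 s1 where 1: "exec c s t1 r1 s1"
        and 2: "if r1 = Finished then Inv s1 (t + 1 + t1) else Q Returned s1 (t + 1 + t1)"
        using step[OF less.prems True] unfolding runs_def by blast
      show ?thesis
      proof (cases r1)
        case Finished
        with 2 have I: "Inv s1 (t + 1 + t1)" by simp
        have "B - (t + 1 + t1) < B - t" using bounded[OF I] by simp
        from less.hyps[OF this I] obtain t2 r2 s2 where
          "exec (While b c) s1 t2 r2 s2" "Q r2 s2 (t + 1 + t1 + t2)"
          unfolding runs_def by blast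
        then show ?thesis using 1 Finished True exec_While_True[of b s c t1 s1 t2 r2 s2]
          unfolding runs_def by (metis add.assoc)
      next
        case Returned
        then show ?thesis using 1 2 True exec_While_Returned[of b s c t1 s1]
          unfolding runs_def by (metis add.assoc outcome.distinct(1))
      qed
    next
      case False
      then show ?thesis using exit[OF less.prems] exec_While_False[of b s c]
        unfolding runs_def by blast
    qed
  qed
  from this[OF inv] show ?thesis by simp
qed

section \<open>Cardinalities of set families\<close>

text \<open>One step of a potential argument: an iteration that takes \<open>q\<close> out of the
  counted set pays its constant cost with this drop.\<close>

lemma card_Collect_remove:
  assumes "finite A" and "q \<in> A" and "Q q" and "\<not> R q" and "\<And>p. p \<in> A \<Longrightarrow> R p \<Longrightarrow> Q p"
  shows "Suc (card {p \<in> A. R p}) \<le> card {p \<in> A. Q p}"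
proof -
  have "card (insert q {p \<in> A. R p}) \<le> card {p \<in> A. Q p}"
    by (rule card_mono) (use assms in auto)
  then show ?thesis using assms by simp
qed

text \<open>Induction on \<open>U\<close>, deleting \<open>x\<close> from every set. Only
  \<open>{x}\<close> becomes empty and only pairs \<open>A\<close>, \<open>A - {x}\<close> merge;
  there is at most one such pair, so each point accounts for at most two sets.\<close>

lemma card_laminar_le:
  assumes "finite U" and "\<And>A. A \<in> F \<Longrightarrow> A \<subseteq> U \<and> A \<noteq> {}"
    and "\<And>A B. A \<in> F \<Longrightarrow> B \<in> F \<Longrightarrow> A \<inter> B \<noteq> {} \<Longrightarrow> A \<subseteq> B \<or> B \<subseteq> A"
  shows "card F \<le> 2 * card U"
  using assms
proof (induction U arbitrary: F rule: finite_induct)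
  case empty
  then have "F = {}" by blast
  then show ?case by simp
next
  case (insert x U)
  have finF: "finite F"
    by (rule finite_subset[of _ "Pow (insert x U)"]) (use insert in auto)
  define D where "D = {A \<in> F. x \<in> A \<and> A - {x} \<in> F}"
  define G where "G = F - D - {{x}}"
  define F' where "F' = (\<lambda>A. A - {x}) ` G"
  have finD: "finite D" using finF unfolding D_def by simp
  \<comment> \<open>\<open>A\<close> and \<open>B - {x}\<close> lie in \<open>F\<close> and share
    the non-empty \<open>A - {x}\<close>, so they are nested. As \<open>x \<in> A\<close>, this must
    be \<open>B - {x} \<subseteq> A\<close>.\<close>
  have D_eq: "A = B" if A: "A \<in> D" and B: "B \<in> D" and le: "A \<subseteq> B" for A B
  proof -
    have "A - {x} \<in> F" "B - {x} \<in> F" "A \<in> F" "x \<in> A" using A B unfolding D_def by auto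
    moreover have "A - {x} \<noteq> {}" using insert.prems(1) \<open>A - {x} \<in> F\<close> by blast
    moreover have "A \<inter> (B - {x}) \<noteq> {}" using \<open>A - {x} \<noteq> {}\<close> le by blast
    ultimately have "A \<subseteq> B - {x} \<or> B - {x} \<subseteq> A" using insert.prems(2) by blast
    then show ?thesis using \<open>x \<in> A\<close> le by blast
  qed
  have "A = B" if "A \<in> D" "B \<in> D" for A B
  proof -
    have "A \<subseteq> B \<or> B \<subseteq> A" using that insert.prems(2)[of A B] unfolding D_def by blast
    then show ?thesis using D_eq that by blast
  qed
  then have cardD: "card D \<le> 1"
    by (metis card_le_Suc0_iff_eq finD One_nat_def)
  have injG: "inj_on (\<lambda>A. A - {x}) G"
  proof (rule inj_onI)
    fix A B assume AB: "A \<in> G" "B \<in> G" and eq: "A - {x} = B - {x}"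
    show "A = B"
    proof (rule ccontr)
      assume "A \<noteq> B"
      then consider "x \<in> A" "B = A - {x}" | "x \<in> B" "A = B - {x}" using eq by blast
      then show False using AB unfolding G_def D_def by cases auto
    qed
  qed
  have "card F' \<le> 2 * card U"
  proof (rule insert.IH)
    fix A assume "A \<in> F'"
    then obtain A' where A': "A' \<in> F" "A' \<noteq> {x}" "A = A' - {x}"
      unfolding F'_def G_def by blast
    then show "A \<subseteq> U \<and> A \<noteq> {}" using insert.prems(1)[of A'] by auto
  next
    fix A B assume "A \<in> F'" "B \<in> F'" and int: "A \<inter> B \<noteq> {}"
    then obtain A' B' where A': "A' \<in> F" "A = A' - {x}" and B': "B' \<in> F" "B = B' - {x}"
      unfolding F'_def G_def by blast
    with int have "A' \<inter> B' \<noteq> {}" by blast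
    then have "A' \<subseteq> B' \<or> B' \<subseteq> A'" using A' B' insert.prems(2) by blast
    then show "A \<subseteq> B \<or> B \<subseteq> A" using A' B' by blast
  qed
  moreover have "card F' = card G" unfolding F'_def using injG by (rule card_image)
  moreover have "card F \<le> card (G \<union> D \<union> {{x}})"
    by (rule card_mono) (use finF finD in \<open>auto simp: G_def\<close>)
  moreover have "card (G \<union> D \<union> {{x}}) \<le> card G + card D + 1"
    by (metis (no_types, lifting) card_Un_le add_le_mono1 order_trans is_singletonI is_singleton_altdef)
  ultimately show ?case using cardD insert.hyps by simp
qed

section \<open>The algorithm on abstract tables\<close>

text \<open>\<open>E q\<close> stands for the set of end positions of the state \<open>q\<close>. The states whose end
  positions include \<open>i \<ge> 1\<close> are ordered by \<open>min_length\<close>; \<open>T[i]\<close> is the largest of them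
  and \<open>suffix_link\<close> is the predecessor.\<close>

locale suffix_tables =
  fixes S :: "'q suffix_automaton" and E :: "'q \<Rightarrow> nat set"
  assumes finite_states: "finite (states S)"
    and init_in: "init_state S \<in> states S"
    and E_le: "q \<in> states S \<Longrightarrow> i \<in> E q \<Longrightarrow> i \<le> word_length S"
    and E_inj: "inj_on E (states S)"
    and first_pos_in: "q \<in> states S \<Longrightarrow> first_pos S q \<in> E q"
    and first_pos_le: "q \<in> states S \<Longrightarrow> i \<in> E q \<Longrightarrow> first_pos S q \<le> i"
    and first_pos_init: "first_pos S (init_state S) = 0"
    and min_length_init: "min_length S (init_state S) = 0"
    and min_length_pos: "q \<in> states S \<Longrightarrow> q \<noteq> init_state S \<Longrightarrow> 1 \<le> min_length S q"
    and min_length_le: "q \<in> states S \<Longrightarrow> i \<in> E q \<Longrightarrow> min_length S q \<le> i"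
    and prefix_state_in: "1 \<le> i \<Longrightarrow> i \<le> word_length S \<Longrightarrow> prefix_state S i \<in> states S"
    and prefix_state_E: "1 \<le> i \<Longrightarrow> i \<le> word_length S \<Longrightarrow> i \<in> E (prefix_state S i)"
    and prefix_state_top: "p \<in> states S \<Longrightarrow> i \<in> E p \<Longrightarrow> 1 \<le> i \<Longrightarrow>
      min_length S p \<le> min_length S (prefix_state S i)"
    and link_in: "q \<in> states S \<Longrightarrow> q \<noteq> init_state S \<Longrightarrow> suffix_link S q \<in> states S"
    and link_E: "q \<in> states S \<Longrightarrow> q \<noteq> init_state S \<Longrightarrow> E q \<subseteq> E (suffix_link S q)"
    and link_less: "q \<in> states S \<Longrightarrow> q \<noteq> init_state S \<Longrightarrow> min_length S (suffix_link S q) < min_length S q"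
    and link_next: "q \<in> states S \<Longrightarrow> q \<noteq> init_state S \<Longrightarrow> p \<in> states S \<Longrightarrow> i \<in> E p \<Longrightarrow> i \<in> E q \<Longrightarrow>
      min_length S p < min_length S q \<Longrightarrow> min_length S p \<le> min_length S (suffix_link S q)"
    and nested: "p \<in> states S \<Longrightarrow> q \<in> states S \<Longrightarrow> i \<in> E p \<Longrightarrow> i \<in> E q \<Longrightarrow>
      min_length S p \<le> min_length S q \<Longrightarrow> E q \<subseteq> E p"
begin

abbreviation "I \<equiv> init_state S"
abbreviation "n \<equiv> word_length S"
abbreviation "N \<equiv> card (states S)"
abbreviation "len \<equiv> min_length S"

text \<open>The end position sets are distinct, non-empty and nested or disjoint. The ground set
  \<open>{0..n}\<close> has \<open>n + 1\<close> points, since the empty word also ends at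
  0.\<close>

lemma card_states_le: "N \<le> 2 * n + 2"
proof -
  have "card (E ` states S) \<le> 2 * card {0..n}"
  proof (rule card_laminar_le)
    fix A assume "A \<in> E ` states S"
    then show "A \<subseteq> {0..n} \<and> A \<noteq> {}" using E_le first_pos_in by fastforce
  next
    fix A B assume "A \<in> E ` states S" "B \<in> E ` states S" "A \<inter> B \<noteq> {}"
    then show "A \<subseteq> B \<or> B \<subseteq> A" using nested by (smt (verit) disjoint_iff imageE nle_le)
  qed simp
  then show ?thesis using card_image[OF E_inj] by simp
qed

text \<open>Both inclusions follow from \<open>nested\<close>, and \<open>E\<close> is injective.
  Hence \<open>len\<close> orders the states at one end position strictly.\<close>

lemma len_eqD:
  assumes "p \<in> states S" "q \<in> states S" "i \<in> E p" "i \<in> E q" "len p = len q"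
  shows "p = q"
  using assms nested[of p q i] nested[of q p i] E_inj by (auto simp: inj_on_def)

lemma link_next':
  assumes "q \<in> states S" "q \<noteq> I" "p \<in> states S" "i \<in> E p" "i \<in> E q"
    "len p > len (suffix_link S q)"
  shows "p = q \<or> len p > len q"
  using assms link_next[of q p i] len_eqD[of p q i] by fastforce

section \<open>Effect and cost of initialization and stacking\<close>

lemma runs_initialization:
  "runs (initialization S) s (\<lambda>r s' t. r = Finished \<and> t \<le> 4 * N + 5 \<and>
     (\<forall>q\<in>states S. dist s' q = \<infinity>) \<and> attr s' = {} \<and> checked s' = {I} \<and> jv s' = n)"
  unfolding initialization_def
  apply simp
  apply (rule runs_While[where B = "4 * N" and Inv = "\<lambda>s t. todo s \<subseteq> states S \<and>
    (\<forall>q\<in>states S - todo s. dist s q = \<infinity>) \<and> t + 4 * card (todo s) \<le> 4 * N"])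
     apply simp
    apply simp
  subgoal premises prems for s t
  proof -
    define q where "q = (SOME q. q \<in> todo s)"
    have q: "q \<in> todo s" using prems(2) someI_ex[of "\<lambda>q. q \<in> todo s"] unfolding q_def by blast
    have "finite (todo s)" using prems(1) finite_states finite_subset by blast
    then have "card (todo s) = Suc (card (todo s - {q}))" using q by (rule card.remove)
    then have "t + 4 + 4 * card (todo s - {q}) \<le> 4 * N" using prems(1) by linarith
    moreover have "((dist s)(q := \<infinity>)) p = \<infinity>" if "p \<in> states S - (todo s - {q})" for p
      using prems(1) that by (cases "p = q") auto
    ultimately show ?thesis
      using prems(1) unfolding runs_Seq runs_Basic q_def[symmetric] by (simp add: subset_iff)
  qed
  subgoal for s t by simp
  done

text \<open>End position sets grow along suffix links, so the states with first position
  \<open>iv s\<close> form the possibly empty upper end of the suffix path. Each is visited once for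
  at most four units; the potential counts those still ahead.\<close>

lemma runs_stacking_walk:
  assumes i: "1 \<le> iv s" "iv s \<le> n" and j: "iv s \<le> j" "kv s \<le> j" and q: "qv s = prefix_state S (iv s)"
  shows "runs (While (\<lambda>s. first_pos S (qv s) = iv s) (
         When (\<lambda>s. dist s (qv s) \<ge> enat (min_length S (qv s)))
           (Basic (\<lambda>s. s\<lparr>kv := max (kv s) (iv s - min_length S (qv s) + 1)\<rparr>)) ;;
         Basic (\<lambda>s. s\<lparr>qv := suffix_link S (qv s)\<rparr>))) s
     (\<lambda>r s' t. r = Finished \<and> t \<le> 4 * card {p \<in> states S. first_pos S p = iv s} + 1 \<and>
        kv s \<le> kv s' \<and> kv s' \<le> j \<and>
        (\<forall>p\<in>states S. first_pos S p = iv s \<and> enat (len p) \<le> dist s p \<longrightarrow> iv s + 1 \<le> kv s' + len p) \<and>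
        dist s' = dist s \<and> attr s' = attr s \<and> checked s' = checked s \<and> jv s' = jv s \<and> iv s' = iv s)"
proof -
  let ?B = "4 * card {p \<in> states S. first_pos S p = iv s}"
  let ?Inv = "\<lambda>s' t. qv s' \<in> states S \<and> iv s \<in> E (qv s') \<and> kv s \<le> kv s' \<and> kv s' \<le> j \<and>
    (\<forall>p\<in>states S. first_pos S p = iv s \<and> enat (len p) \<le> dist s p \<and> len p > len (qv s') \<longrightarrow>
        iv s + 1 \<le> kv s' + len p) \<and>
    dist s' = dist s \<and> attr s' = attr s \<and> checked s' = checked s \<and> jv s' = jv s \<and> iv s' = iv s \<and>
    t + 4 * card {p \<in> states S. first_pos S p = iv s \<and> len p \<le> len (qv s')} \<le> ?B"
  show ?thesis
  proof (rule runs_While[where B = ?B and Inv = ?Inv], goal_cases)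
    case 1
    have "card {p \<in> states S. first_pos S p = iv s \<and> len p \<le> len (qv s)}
      \<le> card {p \<in> states S. first_pos S p = iv s}"
      by (rule card_mono) (use finite_states in auto)
    then show ?case
      using i j prefix_state_in[of "iv s"] prefix_state_E[of "iv s"] prefix_state_top[of _ "iv s"]
        first_pos_in unfolding q by (simp add: q) (metis not_less)
  next
    case (2 s' t)
    then show ?case by linarith
  next
    case (3 s' t)
    define q where "q = qv s'"
    have q: "q \<in> states S" "iv s \<in> E q" "first_pos S q = iv s" using 3 by (simp_all add: q_def)
    then have "q \<noteq> I" using i first_pos_init by auto
    note lk = link_in[OF q(1) this] link_E[OF q(1) this] link_less[OF q(1) this]
    have card: "Suc (card {p \<in> states S. first_pos S p = iv s \<and> len p \<le> len (suffix_link S q)})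
      \<le> card {p \<in> states S. first_pos S p = iv s \<and> len p \<le> len q}"
      by (rule card_Collect_remove[of _ q]) (use finite_states q lk in auto)
    have eq: "p = q \<or> len p > len q"
      if "p \<in> states S" "first_pos S p = iv s" "len p > len (suffix_link S q)" for p
      using link_next'[OF q(1) \<open>q \<noteq> I\<close> that(1) _ q(2) that(3)] first_pos_in[OF that(1)] that(2) by simp
    \<comment> \<open>The upper bound excludes truncation in \<open>iv s - len q + 1\<close>; the
      lower bound keeps the new \<open>kv\<close> within \<open>j\<close>.\<close>
    have "len q \<le> iv s" "1 \<le> len q"
      using q \<open>q \<noteq> I\<close> min_length_le min_length_pos by auto
    then have arith: "iv s - len q + 1 \<le> j" "iv s + 1 \<le> (iv s - len q + 1) + len q" using j by auto
    have E: "iv s \<in> E (suffix_link S q)" using q lk by auto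
    have old: "iv s + 1 \<le> kv s' + len p" if "p \<in> states S" "first_pos S p = iv s"
      "enat (len p) \<le> dist s p" "len p > len q" for p
      using 3 that unfolding q_def by blast
    have A: "iv s + 1 \<le> max (kv s') (iv s - len q + 1) + len p" if "p \<in> states S" "first_pos S p = iv s"
      "enat (len p) \<le> dist s p" "len p > len (suffix_link S q)" for p
      using eq[OF that(1,2,4)] old[OF that(1-3)] arith(2) by auto
    have B: "iv s + 1 \<le> kv s' + len p" if "p \<in> states S" "first_pos S p = iv s"
      "enat (len p) \<le> dist s p" "len p > len (suffix_link S q)" "\<not> enat (len q) \<le> dist s q" for p
      using eq[OF that(1,2,4)] old[OF that(1-3)] that by auto
    have s': "kv s \<le> kv s'" "kv s' \<le> j" "dist s' = dist s" "attr s' = attr s" "checked s' = checked s"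
      "jv s' = jv s" "iv s' = iv s" "t + 4 * card {p \<in> states S. first_pos S p = iv s \<and> len p \<le> len q} \<le> ?B"
      using 3 by (simp_all add: q_def)
    show ?case
    proof (cases "enat (len q) \<le> dist s q")
      case True
      have "kv s \<le> max (kv s') (iv s - len q + 1)" "max (kv s') (iv s - len q + 1) \<le> j"
        using s' arith by auto
      then show ?thesis using True A lk(1) E s' card by (simp flip: q_def)
    next
      case False
      then show ?thesis using B lk(1) E s' card by (simp flip: q_def)
    qed
  next
    case (4 s' t)
    let ?q = "qv s'"
    \<comment> \<open>The states not yet passed contain the end positions of \<open>?q\<close>, so
      their first positions are below \<open>iv s\<close> too: none was missed.\<close>
    have "first_pos S ?q < iv s" using 4 first_pos_le[of ?q "iv s"] by fastforce
    have "len p > len ?q" if "p \<in> states S" "first_pos S p = iv s" for p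
    proof (rule ccontr)
      assume "\<not> len p > len ?q"
      then have "E ?q \<subseteq> E p" using nested[of p ?q "iv s"] 4 that first_pos_in[of p] by simp
      then have "first_pos S p \<le> first_pos S ?q" using first_pos_in[of ?q] first_pos_le[OF that(1)] 4 by blast
      then show False using \<open>first_pos S ?q < iv s\<close> that by simp
    qed
    then show ?case using 4 by simp
  qed
qed

text \<open>Each position pays four units, and each state four more, only at
  \<open>i = POS[q]\<close>. The inequality on \<open>kv s'\<close> is
  \<open>k \<ge> POS[q] - \<ell>[q] + 1\<close> without subtraction.\<close>

lemma runs_stacking:
  assumes j: "1 \<le> jv s" "jv s \<le> n"
  shows "runs (stacking S) s
     (\<lambda>r s' t. r = Finished \<and> t \<le> 4 * jv s + 4 * N + 3 \<and> 1 \<le> kv s' \<and> kv s' \<le> jv s \<and>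
        (\<forall>p\<in>states S. first_pos S p \<le> jv s \<and> enat (len p) \<le> dist s p \<longrightarrow>
           first_pos S p + 1 \<le> kv s' + len p) \<and>
        dist s' = dist s \<and> attr s' = attr s \<and> checked s' = checked s \<and> jv s' = jv s)"
proof -
  let ?Inv = "\<lambda>s' t. 1 \<le> kv s' \<and> kv s' \<le> jv s \<and> iv s' \<le> jv s \<and>
    (\<forall>p\<in>states S. iv s' < first_pos S p \<and> first_pos S p \<le> jv s \<and> enat (len p) \<le> dist s p \<longrightarrow>
           first_pos S p + 1 \<le> kv s' + len p) \<and>
    dist s' = dist s \<and> attr s' = attr s \<and> checked s' = checked s \<and> jv s' = jv s \<and>
    t + 4 * iv s' + 4 * card {p \<in> states S. first_pos S p \<le> iv s'} \<le> 4 * jv s + 4 * N"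
  show ?thesis
    unfolding stacking_def runs_Seq runs_Basic if_True simp_thms
  proof (rule runs_While[where B = "4 * jv s + 4 * N" and Inv = ?Inv], goal_cases)
    case 1
    have "card {p \<in> states S. first_pos S p \<le> jv s} \<le> N"
      by (rule card_mono) (use finite_states in auto)
    then show ?case using j by simp
  next
    case (2 s' t)
    then show ?case by linarith
  next
    case (3 s' t)
    let ?s = "s'\<lparr>qv := prefix_state S (iv s')\<rparr>"
    have i: "1 \<le> iv s'" "iv s' \<le> jv s" "iv s' \<le> n" using 3 j by auto
    have "{p \<in> states S. first_pos S p \<le> iv s'} =
        {p \<in> states S. first_pos S p = iv s'} \<union> {p \<in> states S. first_pos S p \<le> iv s' - 1}"
      using i by auto
    moreover have "{p \<in> states S. first_pos S p = iv s'} \<inter> {p \<in> states S. first_pos S p \<le> iv s' - 1} = {}"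
      using i by auto
    ultimately have card: "card {p \<in> states S. first_pos S p \<le> iv s'} =
      card {p \<in> states S. first_pos S p = iv s'} + card {p \<in> states S. first_pos S p \<le> iv s' - 1}"
      using finite_states by (simp add: card_Un_disjoint)
    have lt: "iv s' - 1 < x \<longleftrightarrow> x = iv s' \<or> iv s' < x" for x using i by auto
    show ?case
      unfolding runs_Seq runs_Basic if_True simp_thms
      apply (rule runs_mono)
       apply (rule runs_stacking_walk[where j = "jv s" and s = ?s])
      using 3 i apply simp_all[5]
      subgoal premises p for r s'' t''
      proof -
        have p: "r = Finished" "t'' \<le> 4 * card {p \<in> states S. first_pos S p = iv s'} + 1"
          "kv s' \<le> kv s''" "kv s'' \<le> jv s" "iv s'' = iv s'"
          "dist s'' = dist s" "attr s'' = attr s" "checked s'' = checked s" "jv s'' = jv s"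
          and new: "\<And>p. p \<in> states S \<Longrightarrow> first_pos S p = iv s' \<Longrightarrow> enat (len p) \<le> dist s p \<Longrightarrow>
            iv s' + 1 \<le> kv s'' + len p"
          using p 3 by simp_all
        have old: "first_pos S p + 1 \<le> kv s'' + len p" if "p \<in> states S" "iv s' < first_pos S p"
          "first_pos S p \<le> jv s" "enat (len p) \<le> dist s p" for p
        proof -
          have "first_pos S p + 1 \<le> kv s' + len p" using 3 that by blast
          then show ?thesis using p(3) by linarith
        qed
        have "t + 1 + (1 + (t'' + 1)) + 4 * (iv s' - 1) +
            4 * card {p \<in> states S. first_pos S p \<le> iv s' - 1} \<le> 4 * jv s + 4 * N"
          using p(2) card 3 i by linarith
        moreover have "first_pos S p + 1 \<le> kv s'' + len p" if "p \<in> states S" "iv s' - 1 < first_pos S p"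
          "first_pos S p \<le> jv s" "enat (len p) \<le> dist s p" for p
          using that new[of p] old[of p] lt[of "first_pos S p"] by metis
        ultimately show ?thesis using p 3 i by simp
      qed
      done
  next
    case (4 s' t)
    \<comment> \<open>States with first position at most \<open>iv s'\<close> were not visited, but
      the exit condition \<open>iv s' < kv s'\<close> already gives their inequality.\<close>
    have "first_pos S p + 1 \<le> kv s' + len p" if "p \<in> states S" "first_pos S p \<le> jv s"
      "enat (len p) \<le> dist s p" for p
      using 4 that by (cases "iv s' < first_pos S p") auto
    then show ?case using 4 by simp
  qed
qed

section \<open>Invariants of the distances and the updating phase\<close>

definition sound :: "('q \<Rightarrow> enat) \<Rightarrow> nat set \<Rightarrow> bool" where
  "sound d P \<longleftrightarrow> (\<forall>q\<in>states S - {I}. \<forall>e. d q = enat e \<longrightarrow> (\<exists>k\<in>P. k + e \<in> E q))"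

text \<open>Justifies leaving a suffix path early: the remaining states already have a small distance.\<close>

definition monotone_dist :: "('q \<Rightarrow> enat) \<Rightarrow> bool" where
  "monotone_dist d \<longleftrightarrow> (\<forall>p\<in>states S - {I}. \<forall>q\<in>states S - {I}. E q \<subseteq> E p \<longrightarrow> d p \<le> d q)"

definition covered :: "('q \<Rightarrow> enat) \<Rightarrow> 'q set" where
  "covered d = {q \<in> states S. q \<noteq> I \<longrightarrow> d q < enat (len q)}"

text \<open>Justifies the test before \<open>Return\<close>, which compares only
  cardinalities.\<close>

lemma covered_if_card_eq:
  "A \<subseteq> covered d \<Longrightarrow> card A = N \<Longrightarrow> covered d = states S"
  using card_subset_eq[OF finite_states, of A] unfolding covered_def by blast

text \<open>The distances while the suffix path of \<open>T[i]\<close> is followed with value \<open>e\<close>, when the states of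
  minimal length above \<open>l\<close> have been passed.\<close>

definition lower :: "nat \<Rightarrow> nat \<Rightarrow> nat \<Rightarrow> ('q \<Rightarrow> enat) \<Rightarrow> 'q \<Rightarrow> enat" where
  "lower i e l d p = (if p \<in> states S \<and> p \<noteq> I \<and> i \<in> E p \<and> l < len p then min (enat e) (d p) else d p)"

text \<open>Threshold 0 excludes no state but \<open>I\<close>, so this is the effect of a complete
  walk.\<close>

lemma lower_0:
  "lower i e 0 d p = (if p \<in> states S \<and> p \<noteq> I \<and> i \<in> E p then min (enat e) (d p) else d p)"
  using min_length_pos[of p] by (auto simp: lower_def)

lemma lower_le: "lower i e l d p \<le> d p"
  by (simp add: lower_def)

lemma covered_mono: "(\<And>p. d' p \<le> d p) \<Longrightarrow> covered d \<subseteq> covered d'"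
  unfolding covered_def using le_less_trans by blast

text \<open>Every lowered state has the end position \<open>i = k + e\<close>, so \<open>k\<close>
  is the new witness.\<close>

lemma sound_lower: "sound d P \<Longrightarrow> k \<in> P \<Longrightarrow> k + e = i \<Longrightarrow> sound (lower i e l d) P"
  unfolding sound_def lower_def min_def by auto

text \<open>If \<open>E q \<subseteq> E p\<close> and \<open>q\<close> is lowered at
  \<open>i\<close>, then \<open>i \<in> E p\<close>, so \<open>p\<close> is capped by the same
  \<open>e\<close>.\<close>

lemma monotone_lower: "monotone_dist d \<Longrightarrow> monotone_dist (lower i e 0 d)"
  unfolding monotone_dist_def lower_0 by (auto simp: min_def intro: order_trans)

text \<open>The states below \<open>q\<close> on the path contain \<open>E q\<close>, so
  monotonicity bounds their distances by \<open>d q \<le> e\<close>: continuing would change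
  nothing. Below \<open>I\<close> there is no state.\<close>

lemma lower_stop:
  assumes "monotone_dist d" "q \<in> states S" "i \<in> E q" "q = I \<or> d q \<le> enat e"
  shows "lower i e (len q) d = lower i e 0 d"
proof
  fix p
  show "lower i e (len q) d p = lower i e 0 d p"
  proof (cases "p \<in> states S \<and> p \<noteq> I \<and> i \<in> E p \<and> len p \<le> len q")
    case True
    then have "q \<noteq> I" using min_length_pos[of p] min_length_init by auto
    moreover have "E q \<subseteq> E p" using nested[of p q i] True assms by simp
    ultimately have "d p \<le> enat e"
      using True assms order_trans unfolding monotone_dist_def by blast
    then show ?thesis using True by (simp add: lower_def min_def)
  next
    case False
    then show ?thesis using min_length_pos by (auto simp: lower_def)
  qed
qed

text \<open>No state at \<open>i\<close> lies strictly between \<open>q\<close> and its suffix link,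
  so moving the threshold to the link affects \<open>q\<close> alone.\<close>

lemma lower_step:
  assumes "q \<in> states S" "i \<in> E q" "q \<noteq> I" "enat e < d q"
  shows "(lower i e (len q) d)(q := enat e) = lower i e (len (suffix_link S q)) d"
proof
  fix p
  show "((lower i e (len q) d)(q := enat e)) p = lower i e (len (suffix_link S q)) d p"
    using assms link_less[OF assms(1,3)] link_next'[OF assms(1,3) _ _ assms(2), of p]
    by (auto simp: lower_def min_def)
qed

text \<open>The potential counts the states of distance above \<open>e\<close>. Each round removes
  its current state from them and costs at most six units, whether it ends normally or in
  \<open>Return\<close>.\<close>

lemma runs_updating_walk:
  assumes i: "1 \<le> iv s" "iv s \<le> n" and k: "k \<in> attr s" "k + ev s = iv s"
    and q: "qv s = prefix_state S (iv s)"
    and sound: "sound (dist s) (attr s)" and mono: "monotone_dist (dist s)"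
    and chk: "checked s \<subseteq> covered (dist s)"
  shows "runs (While (\<lambda>s. qv s \<noteq> init_state S \<and> enat (ev s) < dist s (qv s)) (
         Basic (\<lambda>s. s\<lparr>dist := (dist s)(qv s := enat (ev s))\<rparr>) ;;
         When (\<lambda>s. dist s (qv s) < enat (min_length S (qv s))) (
           Basic (\<lambda>s. s\<lparr>checked := checked s \<union> {qv s}\<rparr>) ;;
           When (\<lambda>s. card (checked s) = card (states S)) Return) ;;
         Basic (\<lambda>s. s\<lparr>qv := suffix_link S (qv s)\<rparr>))) s
     (\<lambda>r s' t. attr s' = attr s \<and> sound (dist s') (attr s) \<and>
        t + 6 * card {p \<in> states S. enat (ev s) < dist s' p} \<le>
          6 * card {p \<in> states S. enat (ev s) < dist s p} + 1 \<and>
        (if r = Finished then dist s' = lower (iv s) (ev s) 0 (dist s) \<and> checked s' \<subseteq> covered (dist s') \<and>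
           iv s' = iv s \<and> kv s' = kv s \<and> jv s' = jv s
         else covered (dist s') = states S))"
proof -
  let ?c = "\<lambda>d. 6 * card {p \<in> states S. enat (ev s) < d p}"
  let ?Inv = "\<lambda>s' t. qv s' \<in> states S \<and> iv s \<in> E (qv s') \<and>
    dist s' = lower (iv s) (ev s) (len (qv s')) (dist s) \<and>
    checked s' \<subseteq> covered (dist s') \<and> attr s' = attr s \<and>
    iv s' = iv s \<and> kv s' = kv s \<and> jv s' = jv s \<and> ev s' = ev s \<and>
    t + ?c (dist s') \<le> ?c (dist s)"
  show ?thesis
  proof (rule runs_While[where B = "?c (dist s)" and Inv = ?Inv], goal_cases)
    case 1
    \<comment> \<open>\<open>T[i]\<close> has the largest \<open>len\<close> at \<open>i\<close>, so
      initially nothing lies above the threshold.\<close>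
    have "dist s = lower (iv s) (ev s) (len (prefix_state S (iv s))) (dist s)"
      using prefix_state_top[of _ "iv s"] i by (auto simp: lower_def fun_eq_iff not_less[symmetric])
    then show ?case
      using i chk prefix_state_in[of "iv s"] prefix_state_E[of "iv s"] by (simp add: q)
  next
    case (2 s' t)
    then show ?case by linarith
  next
    case (3 s' t)
    define q where "q = qv s'"
    define d where "d = (dist s')(q := enat (ev s))"
    have q: "q \<in> states S" "iv s \<in> E q" "q \<noteq> I" "enat (ev s) < dist s' q"
      using 3 unfolding q_def by simp_all
    note lk = link_in[OF q(1,3)] link_E[OF q(1,3)]
    have s': "dist s' = lower (iv s) (ev s) (len q) (dist s)" "checked s' \<subseteq> covered (dist s')"
      "attr s' = attr s" "iv s' = iv s" "kv s' = kv s" "jv s' = jv s" "ev s' = ev s"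
      "t + ?c (dist s') \<le> ?c (dist s)"
      using 3 unfolding q_def by blast+
    have "enat (ev s) < dist s q" using q s' by (simp add: lower_def)
    from lower_step[where d = "dist s", OF q(1-3) this] have d: "d = lower (iv s) (ev s) (len (suffix_link S q)) (dist s)"
      by (simp add: d_def s')
    have "Suc (card {p \<in> states S. enat (ev s) < d p}) \<le> card {p \<in> states S. enat (ev s) < dist s' p}"
      by (rule card_Collect_remove[of _ q]) (use finite_states q in \<open>auto simp: d_def split: if_splits\<close>)
    then have c: "t + 6 + ?c d \<le> ?c (dist s)" using s' by linarith
    have snd: "sound d (attr s)" unfolding d by (rule sound_lower[OF sound k])
    have cov: "checked s' \<subseteq> covered d"
      using s'(2) covered_mono[of d "dist s'"] q(4) by (fastforce simp: d_def)
    have E: "iv s \<in> E (suffix_link S q)" using q lk by auto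
    have dq: "d q = enat (ev s)" by (simp add: d_def)
    note fold = q_def[symmetric] d_def[symmetric] d[symmetric]
    show ?case
    proof (cases "ev s < len q")
      case True
      then have cov': "insert q (checked s') \<subseteq> covered d"
        using cov q(1) by (simp add: covered_def dq)
      show ?thesis
      proof (cases "card (insert q (checked s')) = N")
        case full: True
        have "covered d = states S" using covered_if_card_eq[OF cov' full] .
        then show ?thesis using True full snd c s'(3-8) by (simp add: fold dq)
      next
        case False
        then show ?thesis using True cov' lk(1) E c s'(3-8) by (simp add: fold dq)
      qed
    next
      case False
      then show ?thesis using cov lk(1) E c s'(3-8) by (simp add: fold dq)
    qed
  next
    case (4 s' t)
    let ?q = "qv s'"
    have "?q = I \<or> dist s ?q \<le> enat (ev s)"
      using 4 by (auto simp: lower_def)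
    then have "dist s' = lower (iv s) (ev s) 0 (dist s)"
      using lower_stop[OF mono, of ?q "iv s" "ev s"] 4 by simp
    moreover have "sound (dist s') (attr s)"
      unfolding calculation by (rule sound_lower[OF sound k])
    ultimately show ?case using 4 by auto
  qed
qed

text \<open>The value \<open>e = i - k\<close> increases with \<open>i\<close>, so a state lowered
  once is not lowered again in this sweep. The potential counts states of distance at least
  \<open>e\<close>; each position costs five further units.\<close>

lemma runs_updating:
  assumes k: "1 \<le> kv s" "kv s \<le> jv s" "jv s \<le> n" "kv s \<in> attr s"
    and sound: "sound (dist s) (attr s)" and mono: "monotone_dist (dist s)"
    and chk: "checked s \<subseteq> covered (dist s)"
  shows "runs (updating S) s (\<lambda>r s' t. attr s' = attr s \<and> sound (dist s') (attr s) \<and>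
      t \<le> 5 * (jv s + 1 - kv s) + 6 * N + 2 \<and>
      (if r = Finished then monotone_dist (dist s') \<and> checked s' \<subseteq> covered (dist s') \<and>
         kv s' = kv s \<and> jv s' = jv s \<and> (\<forall>p. dist s' p \<le> dist s p) \<and>
         (\<forall>p\<in>states S - {I}. \<forall>i\<in>E p. kv s \<le> i \<and> i \<le> jv s \<longrightarrow> dist s' p \<le> enat (i - kv s))
       else covered (dist s') = states S))"
proof -
  let ?B = "5 * (jv s + 1 - kv s) + 6 * N"
  let ?c = "\<lambda>i d. 6 * card {p \<in> states S. enat (i - kv s) \<le> d p}"
  let ?Inv = "\<lambda>s' t. attr s' = attr s \<and> sound (dist s') (attr s) \<and> monotone_dist (dist s') \<and>
    checked s' \<subseteq> covered (dist s') \<and> kv s' = kv s \<and> jv s' = jv s \<and> kv s \<le> iv s' \<and> iv s' \<le> jv s + 1 \<and>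
    (\<forall>p. dist s' p \<le> dist s p) \<and>
    (\<forall>p\<in>states S - {I}. \<forall>i\<in>E p. kv s \<le> i \<and> i < iv s' \<longrightarrow> dist s' p \<le> enat (i - kv s)) \<and>
    t + 5 * (jv s + 1 - iv s') + ?c (iv s') (dist s') \<le> ?B"
  show ?thesis
    unfolding updating_def runs_Seq runs_Basic if_True simp_thms
  proof (rule runs_While[where B = ?B and Inv = ?Inv], goal_cases)
    case 1
    have "card {p \<in> states S. enat 0 \<le> dist s p} \<le> N"
      by (rule card_mono) (use finite_states in auto)
    then show ?case using assms by auto
  next
    case (2 s' t)
    then show ?case by linarith
  next
    case (3 s' t)
    let ?i = "iv s'"
    let ?e = "?i - kv s"
    let ?s = "s'\<lparr>ev := ?e, qv := prefix_state S ?i\<rparr>"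
    have s': "attr s' = attr s" "sound (dist s') (attr s)" "monotone_dist (dist s')"
      "checked s' \<subseteq> covered (dist s')" "kv s' = kv s" "jv s' = jv s" "kv s \<le> ?i" "?i \<le> jv s"
      "\<And>p. dist s' p \<le> dist s p"
      "t + 5 * (jv s + 1 - ?i) + ?c ?i (dist s') \<le> ?B"
      and old: "\<And>p i. p \<in> states S \<Longrightarrow> p \<noteq> I \<Longrightarrow> i \<in> E p \<Longrightarrow> kv s \<le> i \<Longrightarrow> i < ?i \<Longrightarrow> dist s' p \<le> enat (i - kv s)"
      using 3 by auto
    have "card {p \<in> states S. enat ?e < dist s' p} \<le> card {p \<in> states S. enat ?e \<le> dist s' p}"
      by (rule card_mono) (use finite_states in auto)
    then have c: "t + 5 * (jv s + 1 - ?i) + 6 * card {p \<in> states S. enat ?e < dist s' p} \<le> ?B"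
      using s'(10) by linarith
    \<comment> \<open>Distance above the current \<open>e\<close> means distance at least the next
      one, which carries the potential over to \<open>i + 1\<close>.\<close>
    have nxt: "enat (Suc ?i - kv s) \<le> x \<longleftrightarrow> enat ?e < x" for x
      using s'(7) by (cases x) auto
    show ?case
      unfolding runs_Seq runs_Basic if_True simp_thms
      apply (rule runs_mono)
       apply (subgoal_tac "s'\<lparr>ev := iv s' - kv s'\<rparr>\<lparr>qv := prefix_state S (iv (s'\<lparr>ev := iv s' - kv s'\<rparr>))\<rparr> = ?s")
        apply (simp only:)
        apply (rule runs_updating_walk[where s = ?s and k = "kv s"])
      using s' k apply simp_all[9]
      subgoal premises p for r s'' t''
      proof (cases "r = Finished")
        case True
        with p s' have q: "attr s'' = attr s" "sound (dist s'') (attr s)"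
          "t'' + 6 * card {p \<in> states S. enat ?e < dist s'' p} \<le> 6 * card {p \<in> states S. enat ?e < dist s' p} + 1"
          "dist s'' = lower ?i ?e 0 (dist s')" "checked s'' \<subseteq> covered (dist s'')"
          "iv s'' = ?i" "kv s'' = kv s" "jv s'' = jv s" by auto
        have time: "t + 1 + (1 + (1 + (t'' + 1))) + 5 * (jv s + 1 - (?i + 1)) + ?c (?i + 1) (dist s'') \<le> ?B"
          using q(3) c s'(8) by (simp add: nxt)
        have le: "dist s'' p \<le> dist s' p" for p unfolding q(4) by (rule lower_le)
        have le': "dist s'' p \<le> dist s p" for p using le s'(9) order_trans by blast
        have new: "dist s'' p \<le> enat (i - kv s)"
          if "p \<in> states S" "p \<noteq> I" "i \<in> E p" "kv s \<le> i" "i < ?i + 1" for p i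
        proof (cases "i = ?i")
          case True
          then show ?thesis unfolding q(4) using that by (simp add: lower_0)
        next
          case False
          then show ?thesis using old[of p i] that le[of p] order_trans by fastforce
        qed
        have "monotone_dist (dist s'')" unfolding q(4) by (rule monotone_lower) (rule s')
        then show ?thesis using True q(1,2,5-8) time le' new s'(7,8) by simp
      next
        case False
        with p s' have "attr s'' = attr s" "sound (dist s'') (attr s)"
          "t'' \<le> 6 * card {p \<in> states S. enat ?e < dist s' p} + 1" "covered (dist s'') = states S"
          by simp_all
        then show ?thesis using False c s'(8) by simp
      qed
      done
  next
    case (4 s' t)
    then show ?case by auto
  qed
qed

section \<open>The main loop\<close>

lemma runs_get_an_attractor:
  "runs (get_an_attractor S) s (\<lambda>r s' t. attr s' \<subseteq> {1..n} \<and> sound (dist s') (attr s') \<and>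
     covered (dist s') = states S \<and> t \<le> 80 * max 1 (n * card (attr s')))"
proof -
  \<comment> \<open>For \<open>n \<ge> 1\<close> an iteration costs at most \<open>9 * n + 10 * N + 8 \<le> 57 * n\<close>, since \<open>N \<le> 4 * n\<close>.\<close>
  let ?Inv = "\<lambda>s t. jv s \<le> n \<and> attr s \<subseteq> {jv s<..n} \<and> sound (dist s) (attr s) \<and>
    monotone_dist (dist s) \<and> checked s \<subseteq> covered (dist s) \<and>
    (\<forall>q\<in>states S. jv s < first_pos S q \<longrightarrow> q \<in> covered (dist s)) \<and>
    (jv s = n \<or> attr s \<noteq> {}) \<and> t \<le> 57 * n * card (attr s)"
  have N: "N \<le> 4 * n" if "1 \<le> n" using card_states_le that by linarith
  \<comment> \<open>For \<open>n, c \<ge> 1\<close> the sum is at most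
    \<open>57 * n * c + 16 * n + 6 \<le> 79 * n * c\<close>; for \<open>n = 0\<close> it is at most
    14.\<close>
  have time: "t \<le> 80 * max 1 (n * c)" if "t \<le> 4 * N + 5 + (57 * n * c + 1)" "n = 0 \<or> 1 \<le> c" for t c
  proof (cases "n = 0")
    case True
    then show ?thesis using that card_states_le by simp
  next
    case False
    then have "N \<le> 4 * n" "1 \<le> c" using N that by simp_all
    moreover have "n \<le> n * c" using \<open>1 \<le> c\<close> by simp
    ultimately have "t \<le> 80 * (n * c)" using that(1) False by linarith
    also have "n * c \<le> max 1 (n * c)" by simp
    finally show ?thesis by simp
  qed
  have loop: "runs (While (\<lambda>s. jv s > 0) (stacking S ;; adding ;; updating S ;; Basic (\<lambda>s. s\<lparr>jv := kv s - 1\<rparr>))) s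
     (\<lambda>r s' t. attr s' \<subseteq> {1..n} \<and> sound (dist s') (attr s') \<and> covered (dist s') = states S \<and>
       t \<le> 57 * n * card (attr s') + 1 \<and> (n = 0 \<or> 1 \<le> card (attr s')))" if "?Inv s 0" for s
  proof (rule runs_While[where B = "57 * n * n" and Inv = ?Inv], goal_cases)
    case 1
    show ?case by (rule that)
  next
    case (2 s t)
    then have "card (attr s) \<le> card {jv s<..n}" by (intro card_mono) auto
    then have "57 * n * card (attr s) \<le> 57 * n * n" by (intro mult_le_mono) auto
    then show ?case using 2 by linarith
  next
    case (3 s t)
    have j: "1 \<le> jv s" "jv s \<le> n" using 3 by simp_all
    show ?case
      unfolding runs_Seq[of "stacking S"]
    proof (rule runs_mono[OF runs_stacking[OF j]], goal_cases)
      case (1 r1 s1 t1)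
      then have s1: "t1 \<le> 4 * jv s + 4 * N + 3" "1 \<le> kv s1" "kv s1 \<le> jv s" "dist s1 = dist s"
        "attr s1 = attr s" "checked s1 = checked s" "jv s1 = jv s" and r1: "r1 = Finished"
        and st: "\<And>p. p \<in> states S \<Longrightarrow> first_pos S p \<le> jv s \<Longrightarrow> enat (len p) \<le> dist s p \<Longrightarrow>
           first_pos S p + 1 \<le> kv s1 + len p" by auto
      define s2 where "s2 = s1\<lparr>attr := attr s1 \<union> {kv s1}\<rparr>"
      have adding: "runs (adding ;; c) s1 Q \<longleftrightarrow> runs c s2 (\<lambda>r s t. Q r s (1 + t))" for c Q
        by (simp add: adding_def s2_def)
      have fin: "finite (attr s)" using 3 finite_subset by blast
      \<comment> \<open>All earlier positions exceed \<open>jv s\<close>, so the new one is fresh;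
        the growth of \<open>attr\<close> by one pays for this iteration.\<close>
      have "kv s1 \<notin> attr s" using 3 s1(3) by auto
      then have card: "card (attr s2) = card (attr s) + 1" using fin s1(5) by (simp add: s2_def)
      have s2: "1 \<le> kv s2" "kv s2 \<le> jv s2" "jv s2 \<le> n" "kv s2 \<in> attr s2"
        "monotone_dist (dist s2)" "checked s2 \<subseteq> covered (dist s2)" "sound (dist s2) (attr s2)"
        using s1 j 3 by (auto simp: s2_def sound_def)
      have time: "t + 1 + (t1 + (1 + (t3 + 1))) \<le> 57 * n * card (attr s2)"
        if "t3 \<le> 5 * (jv s2 + 1 - kv s2) + 6 * N + 2" for t3
      proof -
        have "5 * (jv s2 + 1 - kv s2) \<le> 5 * n" using s2 by simp
        then have "t3 \<le> 5 * n + 6 * N + 2" using that by linarith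
        moreover have "t1 \<le> 4 * n + 4 * N + 3" using s1(1) j by linarith
        moreover have "N \<le> 4 * n" "1 \<le> n" using N j by simp_all
        moreover have "t \<le> 57 * n * card (attr s)" using 3 by simp
        moreover have "57 * n * card (attr s2) = 57 * n * card (attr s) + 57 * n" by (simp add: card)
        ultimately show ?thesis by linarith
      qed
      have attr2: "attr s2 \<subseteq> {kv s1 - 1<..n}" 
      proof
        fix x assume "x \<in> attr s2"
        then consider "x = kv s1" | "x \<in> attr s" using s1(5) by (auto simp: s2_def)
        then show "x \<in> {kv s1 - 1<..n}"
        proof cases
          case 1
          then show ?thesis using s1 j by auto
        next
          case 2
          then have "x \<in> {jv s<..n}" using 3 by blast
          then show ?thesis using s1 by auto
        qed
      qed
      have "runs (updating S ;; Basic (\<lambda>s. s\<lparr>jv := kv s - 1\<rparr>)) s2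
        (\<lambda>r s' t'. if r = Finished then ?Inv s' (t + 1 + (t1 + (1 + t')))
          else attr s' \<subseteq> {1..n} \<and> sound (dist s') (attr s') \<and> covered (dist s') = states S \<and>
            t + 1 + (t1 + (1 + t')) \<le> 57 * n * card (attr s') + 1 \<and> (n = 0 \<or> 1 \<le> card (attr s')))"
        unfolding runs_Seq
      proof (rule runs_mono[OF runs_updating[OF s2(1-4,7,5,6)]], goal_cases)
        case upd: (1 r3 s3 t3)
        show ?case
        proof (cases "r3 = Finished")
          case True
          with upd have s3: "attr s3 = attr s2" "sound (dist s3) (attr s2)"
            "t3 \<le> 5 * (jv s2 + 1 - kv s2) + 6 * N + 2" "monotone_dist (dist s3)"
            "checked s3 \<subseteq> covered (dist s3)" "kv s3 = kv s1" "\<And>p. dist s3 p \<le> dist s p"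
            and cov: "\<And>p i. p \<in> states S \<Longrightarrow> p \<noteq> I \<Longrightarrow> i \<in> E p \<Longrightarrow> kv s1 \<le> i \<Longrightarrow> i \<le> jv s \<Longrightarrow>
              dist s3 p \<le> enat (i - kv s1)"
            using s1(4,7) by (simp_all add: s2_def)
          \<comment> \<open>An uncovered \<open>q\<close> has first position at most
            \<open>jv s\<close> by the invariant. Stacking puts that position less than
            \<open>len q\<close> beyond \<open>k\<close>, and updating there sets a distance below
            \<open>len q\<close>.\<close>
          have "q \<in> covered (dist s3)" if q: "q \<in> states S" "kv s1 - 1 < first_pos S q" for q
          proof (cases "q \<in> covered (dist s)")
            case True
            then show ?thesis using covered_mono[of "dist s3" "dist s"] s3(7) by blast
          next
            case False
            then have "q \<noteq> I" "enat (len q) \<le> dist s q" "first_pos S q \<le> jv s"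
              using 3 q by (force simp: covered_def)+
            moreover have "first_pos S q - kv s1 < len q"
              using st[OF q(1) calculation(3,2)] q(2) s1(2) by linarith
            ultimately show ?thesis
              using cov[OF q(1) _ first_pos_in[OF q(1)]] q s1(2) le_less_trans
              unfolding covered_def by fastforce
          qed
          then show ?thesis
            using True s3 attr2 time[OF s3(3)] s1 j s2(4) by auto
        next
          case False
          with upd have s3: "attr s3 = attr s2" "sound (dist s3) (attr s2)"
            "t3 \<le> 5 * (jv s2 + 1 - kv s2) + 6 * N + 2" "covered (dist s3) = states S"
            by simp_all
          have "t + 1 + (t1 + (1 + t3)) \<le> 57 * n * card (attr s2) + 1" using time[OF s3(3)] by linarith
          then show ?thesis using False s3 attr2 card by auto
        qed
      qed
      then show ?case by (simp only: r1 if_True adding simp_thms)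
    qed
  next
    case (4 s t)
    \<comment> \<open>At \<open>j = 0\<close> the invariant reaches every state but
      \<open>I\<close>, because \<open>POS[q] \<ge> \<ell>[q] \<ge> 1\<close>.\<close>
    then have "covered (dist s) = states S"
      using min_length_pos min_length_le first_pos_in by (fastforce simp: covered_def)
    \<comment> \<open>A non-empty \<open>attr\<close> lets the initialization cost be absorbed into
      \<open>n * card (attr s)\<close>.\<close>
    moreover have "n = 0 \<or> 1 \<le> card (attr s)"
      using 4 finite_subset[of "attr s" "{jv s<..n}"] by (auto simp: Suc_le_eq card_gt_0_iff)
    moreover have "attr s \<subseteq> {1..n}" using 4 by auto
    ultimately show ?case using 4 by simp
  qed
  show ?thesis
    unfolding get_an_attractor_def runs_Seq[of "initialization S"]
  proof (rule runs_mono[OF runs_initialization], goal_cases)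
    case (1 r s' t)
    then have inv: "?Inv s' 0"
      using first_pos_in E_le by (force simp: sound_def monotone_dist_def covered_def init_in)
    have "runs (While (\<lambda>s. jv s > 0) (stacking S ;; adding ;; updating S ;; Basic (\<lambda>s. s\<lparr>jv := kv s - 1\<rparr>))) s'
      (\<lambda>r s' t'. attr s' \<subseteq> {1..n} \<and> sound (dist s') (attr s') \<and>
         covered (dist s') = states S \<and> t + t' \<le> 80 * max 1 (n * card (attr s')))"
    proof (rule runs_mono[OF loop[OF inv]])
      fix r2 s2 t2
      assume *: "attr s2 \<subseteq> {1..n} \<and> sound (dist s2) (attr s2) \<and> covered (dist s2) = states S \<and>
        t2 \<le> 57 * n * card (attr s2) + 1 \<and> (n = 0 \<or> 1 \<le> card (attr s2))"
      have "t + t2 \<le> 4 * N + 5 + (57 * n * card (attr s2) + 1)" using 1 * by linarith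
      from time[OF this] * show "attr s2 \<subseteq> {1..n} \<and> sound (dist s2) (attr s2) \<and>
        covered (dist s2) = states S \<and> t + t2 \<le> 80 * max 1 (n * card (attr s2))" by blast
    qed
    then show ?case using 1 by simp
  qed
qed

end

section \<open>The tables of the suffix automaton\<close>

lemma subword_prefix: "subword w 1 j = take j w"
  by (simp add: subword_def)

text \<open>Treats empty and non-empty words uniformly and reduces occurrences to suffix
  arguments.\<close>

lemma end_positions_eq: "end_positions w u = {j. j \<le> length w \<and> suffix u (take j w)}"
proof (cases "u = []")
  case True
  then show ?thesis by (auto simp: end_positions_def)
next
  case False
  have "(\<exists>i. occurrence w u i j) \<longleftrightarrow> suffix u (take j w)" if j: "j \<le> length w" for j
  proof
    assume "\<exists>i. occurrence w u i j"
    then obtain i where "1 \<le> i" "i \<le> j" "u = subword w i j" by (auto simp: occurrence_def)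
    then have "u = drop (i - 1) (take j w)" by (simp add: subword_def drop_take Suc_diff_le)
    then show "suffix u (take j w)" by (simp add: suffix_drop)
  next
    assume "suffix u (take j w)"
    then obtain v where v: "take j w = v @ u" by (auto simp: suffix_def)
    then have "length v + length u = j" using j by (metis length_append length_take min_absorb2)
    then have len: "length u \<le> j" and "u = drop (j - length u) (take j w)" using v by auto
    then have "u = subword w (j - length u + 1) j"
      by (simp add: subword_def drop_take)
    moreover have "j - length u + 1 \<le> j" using False len by (cases u) auto
    ultimately have "occurrence w u (j - length u + 1) j"
      using len j unfolding occurrence_def by simp
    then show "\<exists>i. occurrence w u i j" by blast
  qed
  then show ?thesis using False by (auto simp: end_positions_def occurrence_def)
qed

lemma occurrence_at_end_position:
  assumes "j \<in> end_positions w u" "u \<noteq> []"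
  shows "occurrence w u (j + 1 - length u) j"
proof -
  obtain i where i: "occurrence w u i j" using assms by (auto simp: end_positions_def)
  then have "length u = j + 1 - i" by (auto simp: occurrence_def subword_def)
  then have "j + 1 - length u = i" using i by (auto simp: occurrence_def)
  then show ?thesis using i by simp
qed

lemma sublist_iff_end_position: "sublist u w \<longleftrightarrow> end_positions w u \<noteq> {}"
  unfolding end_positions_eq sublist_altdef
  by (metis (mono_tags, lifting) empty_Collect_eq linorder_le_cases prefix_length_le
      prefix_def append_eq_conv_conj take_is_prefix)

lemma end_positions_suffix: "suffix u v \<Longrightarrow> end_positions w v \<subseteq> end_positions w u"
  unfolding end_positions_eq by (auto intro: suffix_order.trans)

text \<open>Both words are suffixes of \<open>take i w\<close>, and the suffixes of one word are
  ordered by length.\<close>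

lemma suffix_if_common_end_position:
  "i \<in> end_positions w u \<Longrightarrow> i \<in> end_positions w v \<Longrightarrow> length u \<le> length v \<Longrightarrow> suffix u v"
  unfolding end_positions_eq by (auto intro: suffix_length_suffix)

lemma length_le_end_position: "i \<in> end_positions w u \<Longrightarrow> length u \<le> i"
  unfolding end_positions_eq by (auto dest: suffix_length_le)

section \<open>Classes of factors and their suffix links\<close>

lemma equiv_end_equiv: "equiv {u. sublist u w} (end_equiv w)"
  by (auto simp: equiv_def refl_on_def sym_def trans_def end_equiv_def)

text \<open>All members of a state have the same end positions; the union names this set without
  choosing a member and matches the table \<open>first_pos\<close>.\<close>

definition state_ends :: "'a list \<Rightarrow> 'a list set \<Rightarrow> nat set" where
  "state_ends w q = (\<Union>u\<in>q. end_positions w u)"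

context
  fixes w :: "'a list"
begin

abbreviation "factor_states \<equiv> {u. sublist u w} // end_equiv w"

lemma state_of_in: "sublist u w \<Longrightarrow> state_of w u \<in> factor_states"
  by (simp add: state_of_def quotientI)

lemma in_state_of: "sublist u w \<Longrightarrow> v \<in> state_of w u \<longleftrightarrow> end_positions w v = end_positions w u"
  by (auto simp: state_of_def end_equiv_def sublist_iff_end_position)

lemma state_eq:
  assumes "q \<in> factor_states" "u \<in> q"
  shows "sublist u w" "q = state_of w u" "state_ends w q = end_positions w u"
proof -
  obtain v where v: "sublist v w" "q = state_of w v"
    using assms(1) unfolding quotient_def state_of_def by blast
  then have uv: "end_positions w u = end_positions w v" using assms(2) in_state_of by simp
  then show u: "sublist u w" using v(1) sublist_iff_end_position by metis
  show q: "q = state_of w u"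
    unfolding v(2) set_eq_iff using in_state_of[OF v(1)] in_state_of[OF u] uv by simp
  show "state_ends w q = end_positions w u"
    using in_state_of[OF u] assms(2) unfolding q state_ends_def by auto
qed

lemma finite_factors: "finite {u. sublist u w}"
  by (metis finite_set set_sublists_eq)

lemma finite_state: "q \<in> factor_states \<Longrightarrow> finite q"
  using state_eq(1) finite_factors by (metis (no_types, lifting) finite_subset mem_Collect_eq subsetI)

lemma state_nonempty: "q \<in> factor_states \<Longrightarrow> q \<noteq> {}"
  using in_quotient_imp_non_empty[OF equiv_end_equiv] .

lemma obtain_shortest:
  assumes "q \<in> factor_states"
  obtains u where "u \<in> q" "length u = Min (length ` q)" "\<And>v. v \<in> q \<Longrightarrow> length u \<le> length v"
proof -
  have "Min (length ` q) \<in> length ` q"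
    using finite_state[OF assms] state_nonempty[OF assms] by simp
  then obtain u where "u \<in> q" "length u = Min (length ` q)" by auto
  then show ?thesis using that finite_state[OF assms] by simp
qed

text \<open>A suffix of \<open>x\<close> at least as long as the shortest member \<open>u\<close>
  lies between \<open>u\<close> and \<open>x\<close>, hence has their end positions and belongs to
  \<open>q\<close>. The next shorter suffix is \<open>tl u\<close>, too short for
  \<open>q\<close>.\<close>

lemma link_of_eq:
  assumes q: "q \<in> factor_states" "q \<noteq> state_of w []" and u: "u \<in> q" "\<And>v. v \<in> q \<Longrightarrow> length u \<le> length v"
  shows "link_of w q = state_of w (tl u)"
proof -
  define x where "x = (SOME x. x \<in> q)"
  have x: "x \<in> q" using u(1) unfolding x_def by (rule someI)
  have "u \<noteq> []" using u(1) q state_eq(2)[of _ "[]"] by blast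
  have same: "end_positions w x = end_positions w u"
    using state_eq(3)[OF q(1) x] state_eq(3)[OF q(1) u(1)] by simp
  obtain i where i: "i \<in> end_positions w u"
    using state_eq(1)[OF q(1) u(1)] sublist_iff_end_position by blast
  have ux: "suffix u x" using suffix_if_common_end_position[OF i _ u(2)[OF x]] i same by simp
  let ?P = "\<lambda>s. suffix s x \<and> s \<notin> q"
  have tl: "?P (tl u)"
    using suffix_order.trans[OF suffix_tl ux] \<open>u \<noteq> []\<close> u(2)[of "tl u"] by (auto simp: neq_Nil_conv)
  have max: "length s \<le> length (tl u)" if s: "?P s" for s
  proof (rule ccontr)
    assume "\<not> ?thesis"
    then have "length u \<le> length s" by simp
    then have "suffix u s" using ux s suffix_length_suffix by blast
    then have "end_positions w s = end_positions w u"
      using end_positions_suffix[of u s w] end_positions_suffix[of s x w] s same by auto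
    then have "s \<in> q" using state_eq(1,2)[OF q(1) u(1)] in_state_of by blast
    then show False using s by simp
  qed
  let ?s = "ARG_MAX length s. ?P s"
  \<comment> \<open>The rules for \<open>ARG_MAX\<close> require a strict upper bound, hence
    \<open>length u\<close> rather than \<open>length (tl u)\<close>.\<close>
  have bound: "\<forall>y. ?P y \<longrightarrow> length y < length u"
  proof (intro allI impI)
    fix y assume "?P y"
    from max[OF this] show "length y < length u" using \<open>u \<noteq> []\<close> by (cases u) auto
  qed
  have P: "?P ?s" using arg_max_natI[of ?P "tl u" length "length u", OF tl bound] .
  have "length ?s = length (tl u)"
    using arg_max_nat_le[of ?P "tl u" length "length u", OF tl bound] max[OF P] by simp
  then have "?s = tl u" using P tl by (metis suffix_def append_eq_append_conv)
  then show ?thesis by (simp add: link_of_def x_def Let_def)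
qed

text \<open>The states with end position \<open>i\<close> cut the suffixes of
  \<open>take i w\<close> into intervals of lengths. \<open>T[i]\<close> is the interval of the
  longest ones, and a suffix link leads to the preceding interval.\<close>

lemma suffix_tables_dawg: "suffix_tables (dawg w) (state_ends w)"
proof -
  let ?S = "dawg w"
  let ?I = "state_of w []"
  let ?l = "\<lambda>q. Min (length ` q)"
  have sel: "states ?S = factor_states" "init_state ?S = ?I" "word_length ?S = length w"
    "suffix_link ?S = link_of w" "min_length ?S = ?l"
    "prefix_state ?S = (\<lambda>j. state_of w (take j w))" "first_pos ?S = (\<lambda>q. Min (state_ends w q))"
    by (simp_all add: dawg_def subword_prefix[simplified] state_ends_def)
  have I: "?I \<in> factor_states" by (rule state_of_in) simp
  have I': "[] \<in> ?I" using in_state_of[of "[]" "[]"] by simp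
  have fin: "finite (state_ends w q)" "state_ends w q \<noteq> {}" "\<And>i. i \<in> state_ends w q \<Longrightarrow> i \<le> length w"
    if q: "q \<in> factor_states" for q
  proof -
    obtain u where u: "u \<in> q" using state_nonempty[OF q] by blast
    show "finite (state_ends w q)" "state_ends w q \<noteq> {}" "\<And>i. i \<in> state_ends w q \<Longrightarrow> i \<le> length w"
      using state_eq[OF q u] sublist_iff_end_position by (auto simp: end_positions_eq)
  qed
  have E_I: "state_ends w ?I = {0..length w}"
    using state_eq(3)[OF I I'] by (simp add: end_positions_def)
  \<comment> \<open>Convexity of a class: end positions shrink from \<open>a\<close> to
    \<open>v\<close> to \<open>b\<close>, and those of \<open>a\<close> and \<open>b\<close>
    agree.\<close>
  have between: "v \<in> q" if q: "q \<in> factor_states" and "a \<in> q" "b \<in> q"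
    and v: "i \<in> state_ends w q" "i \<in> end_positions w v" "length a \<le> length v" "length v \<le> length b" for q a b v i
  proof -
    have "suffix a v" "suffix v b"
      using suffix_if_common_end_position v state_eq(3)[OF q] \<open>a \<in> q\<close> \<open>b \<in> q\<close> by blast+
    then have "end_positions w v = end_positions w a"
      using end_positions_suffix state_eq(3)[OF q] \<open>a \<in> q\<close> \<open>b \<in> q\<close> by blast
    then show ?thesis using state_eq(1,2)[OF q \<open>a \<in> q\<close>] in_state_of by blast
  qed
  have nested: "state_ends w q \<subseteq> state_ends w p" if "p \<in> factor_states" "q \<in> factor_states"
    "i \<in> state_ends w p" "i \<in> state_ends w q" "?l p \<le> ?l q" for p q i
  proof -
    note pq = that
    obtain u where u: "u \<in> p" "length u = ?l p" using obtain_shortest[OF pq(1)] by metis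
    obtain v where v: "v \<in> q" "length v = ?l q" using obtain_shortest[OF pq(2)] by metis
    have ends: "state_ends w p = end_positions w u" "state_ends w q = end_positions w v"
      using state_eq(3) pq(1,2) u(1) v(1) by blast+
    have "suffix u v"
      using suffix_if_common_end_position[of i w u v] pq u v ends by simp
    then show ?thesis using end_positions_suffix ends by blast
  qed
  have link: "\<exists>u. u \<in> q \<and> u \<noteq> [] \<and> length u = ?l q \<and> sublist (tl u) w \<and> link_of w q = state_of w (tl u)
      \<and> tl u \<in> link_of w q \<and> link_of w q \<in> factor_states \<and> state_ends w (link_of w q) = end_positions w (tl u)"
    if q: "q \<in> factor_states" "q \<noteq> ?I" for q
  proof -
    obtain u where u: "u \<in> q" "length u = ?l q" "\<And>v. v \<in> q \<Longrightarrow> length u \<le> length v"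
      using obtain_shortest[OF q(1)] by blast
    have eq: "link_of w q = state_of w (tl u)" using link_of_eq[OF q u(1,3)] .
    have sub: "sublist (tl u) w"
      using state_eq(1)[OF q(1) u(1)] end_positions_suffix[OF suffix_tl[of u], of w]
      unfolding sublist_iff_end_position by blast
    then have "tl u \<in> link_of w q" "link_of w q \<in> factor_states"
      using in_state_of[OF sub] state_of_in[OF sub] eq by auto
    then show ?thesis using u eq sub state_eq(2)[of _ "[]"] q state_eq(3) by metis
  qed
  show ?thesis
    unfolding suffix_tables_def sel
  proof (intro conjI allI impI, goal_cases)
    case 1
    show ?case using finite_factors by (rule finite_quotient[OF _ ]) (auto simp: end_equiv_def)
  next
    case 2
    show ?case by (rule I)
  next
    case (3 q i)
    then show ?case using fin by blast
  next
    case 4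
    show ?case
    proof (rule inj_onI)
      fix p q assume pq: "p \<in> factor_states" "q \<in> factor_states" "state_ends w p = state_ends w q"
      obtain u v where "u \<in> p" "v \<in> q" using state_nonempty pq by blast
      then have "v \<in> state_of w u" "p = state_of w u"
        using pq state_eq in_state_of by metis+
      then show "p = q" using state_eq(2)[OF pq(1)] state_eq(2)[OF pq(2)] \<open>v \<in> q\<close> by blast
    qed
  next
    case (5 q)
    then show ?case using fin by simp
  next
    case (6 q i)
    then show ?case using fin by simp
  next
    case 7
    show ?case unfolding E_I by (rule Min_eqI) auto
  next
    case 8
    show ?case using I' finite_state[OF I] by (intro Min_eqI) auto
  next
    case (9 q)
    obtain u where "u \<in> q" "u \<noteq> []" "length u = ?l q" using link[OF 9(1,2)] by blast
    then show ?case by (cases u) auto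
  next
    case (10 q i)
    obtain u where "u \<in> q" "length u = ?l q" using obtain_shortest[OF 10(1)] by metis
    then show ?case using state_eq(3)[OF 10(1)] length_le_end_position 10(2) by metis
  next
    case (11 i)
    then show ?case by (intro state_of_in) (simp add: sublist_take)
  next
    case (12 i)
    then show ?case
      using in_state_of[of "take i w" "take i w"] by (auto simp: state_ends_def end_positions_eq)
  next
    case (13 p i)
    let ?t = "take i w"
    have t: "sublist ?t w" by (simp add: sublist_take)
    have tin: "?t \<in> state_of w ?t" using in_state_of[OF t] by simp
    have "i \<le> length w" using 13 fin by blast
    then have it: "i \<in> end_positions w ?t" by (simp add: end_positions_eq)
    obtain u v where uv: "u \<in> p" "length u = ?l p" "v \<in> state_of w ?t" "length v = ?l (state_of w ?t)"
      using obtain_shortest 13(1) state_of_in[OF t] by metis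
    \<comment> \<open>If \<open>p\<close> were above \<open>T[i]\<close>, its shortest member would
      lie between that of \<open>T[i]\<close> and the whole prefix, so convexity would give
      \<open>p = T[i]\<close>.\<close>
    show ?case
    proof (rule ccontr)
      assume "\<not> ?case"
      then have lt: "length v < length u" using uv by simp
      have "i \<in> end_positions w u" using 13 uv state_eq(3) by blast
      moreover from this have "length u \<le> length ?t"
        using length_le_end_position \<open>i \<le> length w\<close> by fastforce
      ultimately have "u \<in> state_of w ?t"
        using between[OF state_of_in[OF t] uv(3) tin _ _ less_imp_le[OF lt]] it
          state_eq(3)[OF state_of_in[OF t] tin] by blast
      then have "?l (state_of w ?t) \<le> length u"
        using finite_state[OF state_of_in[OF t]] by simp
      moreover have "p = state_of w ?t"
        using \<open>u \<in> state_of w ?t\<close> uv(1) 13(1) state_eq(2) state_of_in[OF t] by metis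
      ultimately show False using \<open>\<not> ?case\<close> by simp
    qed
  next
    case (14 q)
    show ?case using link[OF 14(1,2)] by blast
  next
    case (15 q)
    obtain u where u: "u \<in> q" "state_ends w (link_of w q) = end_positions w (tl u)"
      using link[OF 15(1,2)] by blast
    then show ?case using end_positions_suffix[OF suffix_tl[of u], of w] state_eq(3)[OF 15(1) u(1)] by simp
  next
    case (16 q)
    obtain u where u: "u \<noteq> []" "length u = ?l q" "tl u \<in> link_of w q" "link_of w q \<in> factor_states"
      using link[OF 16(1,2)] by blast
    then have "?l (link_of w q) \<le> length (tl u)"
      by (intro Min_le finite_imageI imageI finite_state u(3,4))
    then show ?case using u by (cases u) auto
  next
    case (17 q p i)
    obtain u where u: "u \<in> q" "u \<noteq> []" "length u = ?l q" "tl u \<in> link_of w q" "link_of w q \<in> factor_states"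
      "state_ends w (link_of w q) = end_positions w (tl u)"
      using link[OF 17(1,2)] by blast
    obtain a b where ab: "a \<in> p" "length a = ?l p" "b \<in> link_of w q" "length b = ?l (link_of w q)"
      using obtain_shortest 17(3) u(5) by metis
    \<comment> \<open>A shortest member \<open>a\<close> of \<open>p\<close> that is longer than
      \<open>b\<close> would lie between the members \<open>b\<close> and \<open>tl u\<close> of the
      link, forcing \<open>p\<close> to be the link.\<close>
    show ?case
    proof (rule ccontr)
      assume "\<not> ?case"
      then have lt: "length b < length a" using ab by simp
      have ia: "i \<in> end_positions w a" using 17 ab state_eq(3) by blast
      have "i \<in> end_positions w u" using 17 u state_eq(3) by blast
      then have "i \<in> state_ends w (link_of w q)"
        using u(6) end_positions_suffix[OF suffix_tl] by blast
      moreover have "length a \<le> length (tl u)" using 17(6) ab u by simp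
      ultimately have "a \<in> link_of w q"
        using between[OF u(5) ab(3) u(4) _ ia] lt by simp
      then have "p = link_of w q" using ab(1) 17(3) state_eq(2) u(5) by metis
      then show False using \<open>\<not> ?case\<close> by simp
    qed
  next
    case (18 p q i)
    then show ?case by (rule nested)
  qed
qed

text \<open>A finite distance \<open>e\<close> gives an occurrence of \<open>u\<close> ending at
  \<open>k + e\<close>. As \<open>e < \<ell>[q] \<le> |u|\<close>, it starts no later than
  \<open>k\<close> and so contains \<open>k\<close>.\<close>

lemma word_attractor_if_covered:
  assumes P: "P \<subseteq> {1..length w}" and snd: "suffix_tables.sound (dawg w) (state_ends w) d P"
    and cov: "suffix_tables.covered (dawg w) d = factor_states"
  shows "word_attractor w P"
proof -
  interpret suffix_tables "dawg w" "state_ends w" by (rule suffix_tables_dawg)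
  have sel: "states (dawg w) = factor_states" "init_state (dawg w) = state_of w []"
    "min_length (dawg w) q = Min (length ` q)" for q by (simp_all add: dawg_def)
  have "\<exists>i j. occurrence w u i j \<and> (\<exists>t\<in>P. i \<le> t \<and> t \<le> j)" if u: "sublist u w" "u \<noteq> []" for u
  proof -
    let ?q = "state_of w u"
    have q: "?q \<in> factor_states" "u \<in> ?q" using state_of_in in_state_of u by auto
    \<comment> \<open>Only the empty word has the end position 0.\<close>
    have "?q \<noteq> state_of w []"
    proof
      assume "?q = state_of w []"
      then have "end_positions w u = end_positions w []" using q(2) in_state_of[of "[]" u] by simp
      then have "0 \<in> end_positions w u" by (simp add: end_positions_eq)
      then show False using u(2) by (simp add: end_positions_eq)
    qed
    moreover from this have "d ?q < enat (Min (length ` ?q))"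
      using cov q(1) unfolding covered_def sel by blast
    moreover from this obtain e where e: "d ?q = enat e" by (cases "d ?q") auto
    ultimately obtain k where k: "k \<in> P" "k + e \<in> state_ends w ?q"
      using snd q(1) unfolding sound_def sel by blast
    have "Min (length ` ?q) \<le> length u" using finite_state[OF q(1)] q(2) by simp
    then have "e < length u" using \<open>d ?q < _\<close> e by simp
    then have "k + e + 1 - length u \<le> k" by simp
    then show ?thesis
      using occurrence_at_end_position[of "k + e" w u] k state_eq(3)[OF q] u(2)
      by (metis le_add1)
  qed
  then show ?thesis using P unfolding word_attractor_def by blast
qed

end

text \<open>The \<open>max 1\<close> serves the empty word, where the product is 0 but
  initialization still takes time. \<open>C\<close> is fixed before the alphabet, the word and the
  initial memory.\<close>

theorem proposition6:
  "\<exists>C::nat. \<forall>(A::'a set) w s. finite A \<longrightarrow> w \<in> lists A \<longrightarrow>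
     (\<exists>P t. runs_from (dawg w) s P t) \<and>
     (\<forall>P t. runs_from (dawg w) s P t \<longrightarrow>
        word_attractor w P \<and> t \<le> C * max 1 (length w * card P))"
proof (intro exI[of _ 80] allI impI)
  fix A :: "'a set" and w :: "'a list" and s :: "'a list set store"
  interpret suffix_tables "dawg w" "state_ends w" by (rule suffix_tables_dawg)
  have sel: "states (dawg w) = {u. sublist u w} // end_equiv w" "word_length (dawg w) = length w"
    by (simp_all add: dawg_def)
  obtain t r s' where run: "exec (get_an_attractor (dawg w)) s t r s'"
    and res: "attr s' \<subseteq> {1..length w}" "sound (dist s') (attr s')"
      "covered (dist s') = states (dawg w)" "t \<le> 80 * max 1 (length w * card (attr s'))"
    using runs_get_an_attractor[of s] unfolding runs_def sel(2) by blast
  have "word_attractor w (attr s')"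
    using word_attractor_if_covered res(1-3) unfolding sel by blast
  moreover have "P = attr s' \<and> t' = t" if "runs_from (dawg w) s P t'" for P t'
    using that exec_deterministic[OF run] unfolding runs_from_def by blast
  moreover have "runs_from (dawg w) s (attr s') t" using run unfolding runs_from_def by blast
  ultimately show "(\<exists>P t. runs_from (dawg w) s P t) \<and>
     (\<forall>P t. runs_from (dawg w) s P t \<longrightarrow>
        word_attractor w P \<and> t \<le> 80 * max 1 (length w * card P))"
    using res(4) by blast
qed

end
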